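(* Let $(X,\mathcal A,\mathbb P)$ be a probability space with relations $\le_k$, $k\in[m]$, as in the context, let $N\ge m$ and $\alpha\in[0,1]$. Suppose $\mathfrak D$ satisfies (A1) on $(X,\mathcal A,\mathbb P)$, and the extended space $(\mathfrak X,\mathcal A\otimes\mathcal L,\mathbb P_\lambda)$ with its extended relations satisfies (A2)–(A5). Then \[\mathbb P^N\{\mathbf x\in X^N:\mathfrak D(\mathbf x)<1-\alpha\}\le\sum_{k=0}^{m-1}\binom{N}{k}\alpha^k(1-\alpha)^{N-k}.\]
   Context: $(X,\mathcal A,\mathbb P)$ is a probability space, $m\in\mathbb N$, $[m]=\{1,\dots,m\}$. For each $k\in[m]$, $\le_k$ is a reflexive, transitive, total relation on $X$ (antisymmetry not required); $x=_ky$ means $x\le_ky$ and $y\le_kx$; $x<_ky$ means $x\le_ky$ and not $x=_ky$; $x\ge_ky$ means $y\le_kx$. $\mathcal A$ contains $\{y:y=_kx\}$ and $\{y:y\le_kx\}$ for all $x,k$. $\mathbb P^N$ is the completion of the product measure on $X^N$. For $\mathbf x\in X^N$: $h_k(\mathbf x)$ is an entry $y$ of $\mathbf x$ with $y\le_kx_i$ for all $i$; $\mathfrak D(\mathbf x)=\mathbb P\{x:h_k(\mathbf x)\le_kx\ \forall k\in[m]\}$. Extended space: $\mathfrak X=X\times[0,1]$, $\mathcal L$ the Lebesgue $\sigma$-algebra on $[0,1]$, $\lambda$ Lebesgue measure, $\mathbb P_\lambda=\mathbb P\times\lambda$, and $(x,s)\le_k(y,t)$ iff $x<_ky$, or $x=_ky$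 and $s\le t$; $\mathbb P_\lambda^N$ is the completed product measure on $\mathfrak X^N$. For a generic space $(Y,\mathcal B,Q)$ with such relations (applied to the extended space): for $\mathbf y\in Y^N$, $\tilde{\mathbf y}$ is a permutation of its entries with $\tilde y_k\le_k\tilde y_i$ for all $k\le i\le N$, $k\in[m]$; $\delta_k(\mathbf y)=Q\{y:y<_j\tilde y_j\text{ for some }j\in[k]\}$; $S_k(y)=Q\{z:z\ge_ky\}$. Conditions: (A1) $\mathfrak D$ is measurable w.r.t. the completed product $\sigma$-algebra; (A2) each $\delta_k$ is measurable; (A3) $\{y:S_k(y)=\beta\}\in\mathcal B$ for all $k$, $\beta\in[0,1]$; (A4) for each $k$ and each $Z\in\mathcal B$ with $Q(Z)>0$, $\sup_{y,y'\in Z}Q\{z\in Z:y\le_kz\le_ky'\}>0$; (A5) for each $k\in[m]$, $\{\mathbf y\in Y^N:y_j=_j\tilde y_j,\ j\in[k]\}$ is measurable. *)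

theory Defs
  imports "HOL-Probability.Probability"
begin

text \<open>Relations are given as a family le :: nat => 'b => 'b => bool, indexed by k in {1..m}.
  Vectors in Y^N are functions on the index set {1..N} (elements of PiE {1..N}).\<close>

definition eqr :: "(nat \<Rightarrow> 'b \<Rightarrow> 'b \<Rightarrow> bool) \<Rightarrow> nat \<Rightarrow> 'b \<Rightarrow> 'b \<Rightarrow> bool" where
  "eqr le k x y \<longleftrightarrow> le k x y \<and> le k y x"

definition ltr :: "(nat \<Rightarrow> 'b \<Rightarrow> 'b \<Rightarrow> bool) \<Rightarrow> nat \<Rightarrow> 'b \<Rightarrow> 'b \<Rightarrow> bool" where
  "ltr le k x y \<longleftrightarrow> le k x y \<and> \<not> eqr le k x y"

definition ordered_space :: "'b measure \<Rightarrow> nat \<Rightarrow> (nat \<Rightarrow> 'b \<Rightarrow> 'b \<Rightarrow> bool) \<Rightarrow> bool" where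
  "ordered_space Q m le \<longleftrightarrow>
     (\<forall>k\<in>{1..m}.
        (\<forall>x\<in>space Q. le k x x) \<and>
        (\<forall>x\<in>space Q. \<forall>y\<in>space Q. \<forall>z\<in>space Q. le k x y \<longrightarrow> le k y z \<longrightarrow> le k x z) \<and>
        (\<forall>x\<in>space Q. \<forall>y\<in>space Q. le k x y \<or> le k y x) \<and>
        (\<forall>x\<in>space Q. {y \<in> space Q. eqr le k y x} \<in> sets Q) \<and>
        (\<forall>x\<in>space Q. {y \<in> space Q. le k y x} \<in> sets Q))"

definition powN :: "'b measure \<Rightarrow> nat \<Rightarrow> (nat \<Rightarrow> 'b) measure" where
  "powN Q N = completion (PiM {1..N} (\<lambda>_. Q))"

definition hmin :: "(nat \<Rightarrow> 'b \<Rightarrow> 'b \<Rightarrow> bool) \<Rightarrow> nat \<Rightarrow> nat \<Rightarrow> (nat \<Rightarrow> 'b) \<Rightarrow> 'b" where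
  "hmin le N k x = (SOME y. y \<in> x ` {1..N} \<and> (\<forall>i\<in>{1..N}. le k y (x i)))"

definition Dfun :: "'b measure \<Rightarrow> nat \<Rightarrow> (nat \<Rightarrow> 'b \<Rightarrow> 'b \<Rightarrow> bool) \<Rightarrow> nat \<Rightarrow> (nat \<Rightarrow> 'b) \<Rightarrow> real" where
  "Dfun Q m le N x = measure Q {z \<in> space Q. \<forall>k\<in>{1..m}. le k (hmin le N k x) z}"

definition ext_space :: "'a measure \<Rightarrow> ('a \<times> real) measure" where
  "ext_space P = P \<Otimes>\<^sub>M restrict_space lebesgue {0..1}"

definition ext_rel :: "(nat \<Rightarrow> 'a \<Rightarrow> 'a \<Rightarrow> bool) \<Rightarrow> nat \<Rightarrow> ('a \<times> real) \<Rightarrow> ('a \<times> real) \<Rightarrow> bool" where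
  "ext_rel le k p q \<longleftrightarrow> ltr le k (fst p) (fst q) \<or> (eqr le k (fst p) (fst q) \<and> snd p \<le> snd q)"

definition valid_tilde :: "'b measure \<Rightarrow> nat \<Rightarrow> (nat \<Rightarrow> 'b \<Rightarrow> 'b \<Rightarrow> bool) \<Rightarrow> nat
    \<Rightarrow> ((nat \<Rightarrow> 'b) \<Rightarrow> nat \<Rightarrow> 'b) \<Rightarrow> bool" where
  "valid_tilde Q m le N tilde \<longleftrightarrow>
     (\<forall>y \<in> PiE {1..N} (\<lambda>_. space Q).
        (\<exists>\<pi>. \<pi> permutes {1..N} \<and> (\<forall>i\<in>{1..N}. tilde y i = y (\<pi> i))) \<and>
        (\<forall>k\<in>{1..m}. \<forall>i. k \<le> i \<and> i \<le> N \<longrightarrow> le k (tilde y k) (tilde y i)))"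

definition delta :: "'b measure \<Rightarrow> (nat \<Rightarrow> 'b \<Rightarrow> 'b \<Rightarrow> bool) \<Rightarrow> ((nat \<Rightarrow> 'b) \<Rightarrow> nat \<Rightarrow> 'b)
    \<Rightarrow> nat \<Rightarrow> (nat \<Rightarrow> 'b) \<Rightarrow> real" where
  "delta Q le tilde k y = measure Q {z \<in> space Q. \<exists>j\<in>{1..k}. ltr le j z (tilde y j)}"

definition Sfun :: "'b measure \<Rightarrow> (nat \<Rightarrow> 'b \<Rightarrow> 'b \<Rightarrow> bool) \<Rightarrow> nat \<Rightarrow> 'b \<Rightarrow> real" where
  "Sfun Q le k y = measure Q {z \<in> space Q. le k y z}"

definition condA1 :: "'b measure \<Rightarrow> nat \<Rightarrow> (nat \<Rightarrow> 'b \<Rightarrow> 'b \<Rightarrow> bool) \<Rightarrow> nat \<Rightarrow> bool" where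
  "condA1 Q m le N \<longleftrightarrow> Dfun Q m le N \<in> borel_measurable (powN Q N)"

definition condA2 :: "'b measure \<Rightarrow> nat \<Rightarrow> (nat \<Rightarrow> 'b \<Rightarrow> 'b \<Rightarrow> bool) \<Rightarrow> nat
    \<Rightarrow> ((nat \<Rightarrow> 'b) \<Rightarrow> nat \<Rightarrow> 'b) \<Rightarrow> bool" where
  "condA2 Q m le N tilde \<longleftrightarrow> (\<forall>k\<in>{1..m}. delta Q le tilde k \<in> borel_measurable (powN Q N))"

definition condA3 :: "'b measure \<Rightarrow> nat \<Rightarrow> (nat \<Rightarrow> 'b \<Rightarrow> 'b \<Rightarrow> bool) \<Rightarrow> bool" where
  "condA3 Q m le \<longleftrightarrow>
     (\<forall>k\<in>{1..m}. \<forall>\<beta>\<in>{0..1::real}. {y \<in> space Q. Sfun Q le k y = \<beta>} \<in> sets Q)"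

definition condA4 :: "'b measure \<Rightarrow> nat \<Rightarrow> (nat \<Rightarrow> 'b \<Rightarrow> 'b \<Rightarrow> bool) \<Rightarrow> bool" where
  "condA4 Q m le \<longleftrightarrow>
     (\<forall>k\<in>{1..m}. \<forall>Z\<in>sets Q. measure Q Z > 0 \<longrightarrow>
        (SUP p\<in>Z \<times> Z. measure Q {z \<in> Z. le k (fst p) z \<and> le k z (snd p)}) > 0)"

definition condA5 :: "'b measure \<Rightarrow> nat \<Rightarrow> (nat \<Rightarrow> 'b \<Rightarrow> 'b \<Rightarrow> bool) \<Rightarrow> nat
    \<Rightarrow> ((nat \<Rightarrow> 'b) \<Rightarrow> nat \<Rightarrow> 'b) \<Rightarrow> bool" where
  "condA5 Q m le N tilde \<longleftrightarrow>
     (\<forall>k\<in>{1..m}. {y \<in> space (powN Q N). \<forall>j\<in>{1..k}. eqr le j (y j) (tilde y j)}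
                  \<in> sets (powN Q N))"

end

theory Submission
  imports Defs
begin

text \<open>On the extended space, (A3) and (A4) make every \<^term>\<open>Sfun Q le k\<close> measurable with null level
  sets. Hence almost surely each of the orders is the order of the real numbers
  \<open>U k = - Sfun Q le (k + 1)\<close> on the sample, without ties. The points \<open>tilde y 1, ..., tilde y m\<close>
  are obtained by peeling off successive minima. Let \<open>q\<close> be the mass of the residual set, whose points lie
  strictly above each peeled point in its own order. Given the peeled points, all the other \<open>N - m\<close> sample
  points lie in the residual set with probability \<open>q^(N - m)\<close>, and one step of peeling replaces the
  residual mass by a uniform variable below it. So integrate \<open>v^(N - m) 1[v < 1 - \<alpha>]\<close> successively \<open>m\<close>
  times from 0, evaluate at 1, and multiply by the number \<open>N! / (N - m)!\<close> of peeling orders: this gives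
  the binomial sum. Finally \<open>q \<le> D(x)\<close>, where \<open>x\<close> is the projection of the extended sample.\<close>

subsection \<open>The probability integral transform\<close>

text \<open>Without atoms the tail mass \<open>T u\<close> of \<open>U\<close> is continuous, so
  \<open>T (U x)\<close> is distributed as Lebesgue measure on the interval from 0 to the total
  mass. The measure is not normalised because the lemma is applied to restrictions of a probability
  measure.\<close>

lemma (in finite_measure) nn_integral_upper_mass:
  fixes U :: "'a \<Rightarrow> real" and g :: "real \<Rightarrow> ennreal"
  assumes U [measurable]: "U \<in> borel_measurable M"
    and null: "\<And>c. measure M {x \<in> space M. U x = c} = 0"
    and g [measurable]: "g \<in> borel_measurable borel"
  shows "(\<integral>\<^sup>+x. g (measure M {z \<in> space M. U x < U z}) \<partial>M) =
    (\<integral>\<^sup>+v. g v * indicator {0..measure M (space M)} v \<partial>lborel)"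
proof -
  define w where "w = measure M (space M)"
  define T where "T u = measure M {z \<in> space M. u < U z}" for u
  interpret D: finite_borel_measure "distr M borel U"
    by (simp add: finite_borel_measure_def finite_borel_measure_axioms_def finite_measure_distr)
  have w0: "0 \<le> w" by (simp add: w_def)
  have T_le: "T u \<le> w" and T_ge: "0 \<le> T u" for u
    unfolding T_def w_def by (auto intro!: finite_measure_mono)
  have T_cdf: "T u = w - cdf (distr M borel U) u" for u
  proof -
    have "cdf (distr M borel U) u = measure M (U -` {..u} \<inter> space M)"
      by (simp add: cdf_def2 measure_distr)
    moreover have "{z \<in> space M. u < U z} = space M - (U -` {..u} \<inter> space M)" by auto
    ultimately show ?thesis unfolding T_def w_def by (simp add: finite_measure_compl)
  qed
  have T_fun: "T = (\<lambda>u. w - cdf (distr M borel U) u)" using T_cdf by auto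
  have anti: "T v \<le> T u" if "u \<le> v" for u v
    using that by (simp add: T_cdf D.cdf_nondecreasing)
  have [measurable]: "T \<in> borel_measurable borel"
    unfolding T_fun using borel_measurable_mono[OF monoI[OF D.cdf_nondecreasing]] by measurable
  have cont: "isCont T u" for u
  proof -
    have "measure (distr M borel U) {u} = measure M (U -` {u} \<inter> space M)"
      by (simp add: measure_distr)
    also have "U -` {u} \<inter> space M = {x \<in> space M. U x = u}" by auto
    finally have "isCont (cdf (distr M borel U)) u" using null by (simp add: D.isCont_cdf)
    then show ?thesis unfolding T_fun by (intro continuous_intros)
  qed
  have lims: "(T \<longlongrightarrow> w - w) at_top" "(T \<longlongrightarrow> w - 0) at_bot"
    unfolding T_fun using tendsto_diff[OF tendsto_const D.cdf_lim_at_top, of w]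
      tendsto_diff[OF tendsto_const D.cdf_lim_at_bot, of w]
    by (auto simp: measure_distr w_def)
  have ivt: "\<exists>u. T u = t" if "0 < t" "t < w" for t
  proof -
    have "eventually (\<lambda>u. T u < t) at_top" "eventually (\<lambda>u. t < T u) at_bot"
      using order_tendstoD(2)[OF lims(1), of t] order_tendstoD(1)[OF lims(2), of t] that by auto
    then obtain a b where ab: "\<And>u. b \<le> u \<Longrightarrow> T u < t" "\<And>u. u \<le> a \<Longrightarrow> t < T u"
      unfolding eventually_at_top_linorder eventually_at_bot_linorder by blast
    have "\<exists>u. min a b \<le> u \<and> u \<le> b \<and> T u = t"
      using cont ab(1)[of b] ab(2)[of "min a b"] by (intro IVT2) auto
    then show ?thesis by blast
  qed
  have cdf_TU: "measure M {x \<in> space M. T (U x) \<le> t} = t" if "0 \<le> t" "t < w" for t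
  proof (rule antisym)
    show "measure M {x \<in> space M. T (U x) \<le> t} \<le> t"
    proof (rule dense_ge_bounded[OF \<open>t < w\<close>])
      \<comment> \<open>\<open>T\<close> may be flat at height \<open>t\<close>, so the event is
        compared with the strict tail \<open>u < U x\<close> at a slightly larger height
        \<open>s\<close>.\<close>
      fix s assume s: "t < s" "s < w"
      then obtain u where u: "T u = s" using ivt[of s] \<open>0 \<le> t\<close> by fastforce
      have "{x \<in> space M. T (U x) \<le> t} \<subseteq> {x \<in> space M. u < U x}"
        using anti u s by (force simp: not_less[symmetric])
      then have "measure M {x \<in> space M. T (U x) \<le> t} \<le> T u"
        unfolding T_def[of u] by (intro finite_measure_mono) auto
      then show "measure M {x \<in> space M. T (U x) \<le> t} \<le> s" using u by simp
    qed
    show "t \<le> measure M {x \<in> space M. T (U x) \<le> t}"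
    \<comment> \<open>The value 0 need not be attained by \<open>T\<close>, but for
      \<open>t = 0\<close> the bound is trivial.\<close>
    proof (cases "t = 0")
      case False
      then obtain u where u: "T u = t" using ivt[of t] \<open>0 \<le> t\<close> \<open>t < w\<close> by force
      have "T u \<le> measure M {x \<in> space M. T (U x) \<le> t}"
        unfolding T_def[of u] using anti[of u] u by (intro finite_measure_mono) auto
      then show ?thesis using u by simp
    qed simp
  qed
  have eq: "distr M borel (\<lambda>x. T (U x)) = density lborel (indicator {0..w})"
  proof (rule cdf_unique')
    show "finite_borel_measure (distr M borel (\<lambda>x. T (U x)))"
      by (simp add: finite_borel_measure_def finite_borel_measure_axioms_def finite_measure_distr)
    show "finite_borel_measure (density lborel (indicator {0..w}))"
      using w0 by (auto simp: finite_borel_measure_def finite_borel_measure_axioms_def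
          emeasure_density intro!: finite_measureI)
    show "cdf (distr M borel (\<lambda>x. T (U x))) = cdf (density lborel (indicator {0..w}))"
    proof
      fix t
      have "cdf (distr M borel (\<lambda>x. T (U x))) t = measure M {x \<in> space M. T (U x) \<le> t}"
        by (simp add: cdf_def2 measure_distr vimage_def Int_def conj_commute)
      also have "\<dots> = (if t < 0 then 0 else if t < w then t else w)"
      proof -
        have "measure M {x \<in> space M. T (U x) \<le> t} = 0" if "t < 0"
        proof -
          have "{x \<in> space M. T (U x) \<le> t} = {}" using that by (auto dest: order_trans[OF T_ge])
          then show ?thesis by (metis measure_empty)
        qed
        moreover have "w \<le> t \<Longrightarrow> {x \<in> space M. T (U x) \<le> t} = space M"
          using T_le order_trans by blast
        ultimately show ?thesis
          using cdf_TU w0 by (cases "t < 0"; cases "t < w") (simp_all add: w_def[symmetric])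
      qed
      also have "\<dots> = measure lborel {0..min w t}" using w0 by auto
      also have "\<dots> = cdf (density lborel (indicator {0..w})) t"
      proof -
        have "(\<integral>\<^sup>+x. indicator {0..w} x * indicator {..t} x \<partial>lborel) =
            (\<integral>\<^sup>+x. indicator {0..min w t} x \<partial>lborel)"
          by (intro nn_integral_cong) (auto split: split_indicator)
        then have "emeasure (density lborel (indicator {0..w})) {..t} = emeasure lborel {0..min w t}"
          by (simp add: emeasure_density)
        then show ?thesis by (simp add: cdf_def2 measure_def)
      qed
      finally show "cdf (distr M borel (\<lambda>x. T (U x))) t = cdf (density lborel (indicator {0..w})) t" .
    qed
  qed
  have "(\<integral>\<^sup>+x. g (T (U x)) \<partial>M) = (\<integral>\<^sup>+v. g v \<partial>distr M borel (\<lambda>x. T (U x)))"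
    by (subst nn_integral_distr) auto
  also have "\<dots> = (\<integral>\<^sup>+v. g v * indicator {0..w} v \<partial>lborel)"
    unfolding eq by (subst nn_integral_density) (auto simp: mult.commute)
  finally show ?thesis by (simp add: T_def w_def)
qed

text \<open>This is the transform for the restriction of \<open>M\<close> to \<open>G\<close>, where
  level sets of \<open>U\<close> remain null. In a peeling step \<open>G\<close> is the residual set
  before the step, and the argument of \<open>g\<close> is the mass that remains after it.\<close>

lemma (in finite_measure) set_nn_integral_upper_mass:
  fixes U :: "'a \<Rightarrow> real" and g :: "real \<Rightarrow> ennreal"
  assumes U [measurable]: "U \<in> borel_measurable M"
    and null: "\<And>c. measure M {x \<in> space M. U x = c} = 0"
    and g [measurable]: "g \<in> borel_measurable borel" and G [measurable]: "G \<in> sets M"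
  shows "(\<integral>\<^sup>+x. g (measure M {z \<in> G. U x < U z}) * indicator G x \<partial>M) =
    (\<integral>\<^sup>+v. g v * indicator {0..measure M G} v \<partial>lborel)"
proof -
  interpret R: finite_measure "restrict_space M G"
    using finite_measure_axioms by (rule finite_measure_restrict_space) simp
  have sp: "space (restrict_space M G) = G"
    using sets.sets_into_space[OF G] by (auto simp: space_restrict_space)
  have "measure (restrict_space M G) {x \<in> G. U x = c} = 0" for c
  proof -
    have "measure (restrict_space M G) {x \<in> G. U x = c} = measure M {x \<in> G. U x = c}"
      using G sets.sets_into_space[OF G] by (subst measure_restrict_space) auto
    also have "\<dots> \<le> measure M {x \<in> space M. U x = c}"
      using sets.sets_into_space[OF G] by (intro finite_measure_mono) auto
    finally show ?thesis using null[of c] by (simp add: measure_le_0_iff)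
  qed
  then have "(\<integral>\<^sup>+x. g (measure (restrict_space M G) {z \<in> G. U x < U z}) \<partial>restrict_space M G) =
      (\<integral>\<^sup>+v. g v * indicator {0..measure (restrict_space M G) G} v \<partial>lborel)"
    using R.nn_integral_upper_mass[of U g] U g by (simp add: sp measurable_restrict_space1)
  then show ?thesis
    using G sets.sets_into_space[OF G]
    by (simp add: nn_integral_restrict_space measure_restrict_space Collect_conj_eq)
qed

subsection \<open>Peeling off successive minima\<close>

text \<open>The list \<open>s\<close> holds sample indices in peeling order. Positions start at 0,
  so position \<open>k\<close> will belong to the order numbered \<open>k + 1\<close>. Only
  coordinates in \<open>set s\<close> enter, which allows the other sample points to be integrated
  out separately.\<close>

definition peeled :: "(nat \<Rightarrow> 'a \<Rightarrow> real) \<Rightarrow> nat list \<Rightarrow> (nat \<Rightarrow> 'a) \<Rightarrow> bool" where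
  "peeled U s y \<longleftrightarrow> (\<forall>l<length s. \<forall>k<l. U k (y (s ! k)) < U k (y (s ! l)))"

text \<open>For the empty list this is the whole space, of mass 1. If each peeled point is the
  minimum of what was left, every unpeeled sample point lies in this set, ties excepted.\<close>

definition residual :: "'a measure \<Rightarrow> (nat \<Rightarrow> 'a \<Rightarrow> real) \<Rightarrow> nat list \<Rightarrow> (nat \<Rightarrow> 'a) \<Rightarrow> 'a set" where
  "residual M U s y = {z \<in> space M. \<forall>k<length s. U k (y (s ! k)) < U k z}"

text \<open>For \<open>z\<close> in the space, the new condition is membership in the residual set
  of the earlier points. Since \<open>a\<close> is new, the update leaves those points
  alone.\<close>

lemma peeled_snoc:
  assumes "a \<notin> set s"
  shows "peeled U (s @ [a]) (y(a := z)) \<longleftrightarrow> peeled U s y \<and> (\<forall>k<length s. U k (y (s ! k)) < U k z)"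
proof -
  have "s ! k \<noteq> a" if "k < length s" for k using assms that nth_mem by metis
  then show ?thesis unfolding peeled_def by (auto simp: nth_append less_Suc_eq)
qed

lemma residual_snoc:
  assumes "a \<notin> set s"
  shows "residual M U (s @ [a]) (y(a := z)) = {x \<in> residual M U s y. U (length s) z < U (length s) x}"
proof -
  have "s ! k \<noteq> a" if "k < length s" for k using assms that nth_mem by metis
  then show ?thesis unfolding residual_def by (auto simp: nth_append less_Suc_eq)
qed

lemma peeled_cong: "(\<And>i. i \<in> set s \<Longrightarrow> x i = y i) \<Longrightarrow> peeled U s x = peeled U s y"
  unfolding peeled_def by (auto simp: nth_mem)

lemma residual_cong: "(\<And>i. i \<in> set s \<Longrightarrow> x i = y i) \<Longrightarrow> residual M U s x = residual M U s y"
  unfolding residual_def by (auto simp: nth_mem)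

context prob_space
begin

lemma measurable_peeled:
  assumes [measurable]: "\<And>k. k < length s \<Longrightarrow> U k \<in> borel_measurable M" and "set s \<subseteq> I"
  shows "Measurable.pred (PiM I (\<lambda>_. M)) (peeled U s)"
proof -
  have [measurable]: "(\<lambda>y. U k (y (s ! l))) \<in> borel_measurable (PiM I (\<lambda>_. M))"
    if "k < length s" "l < length s" for k l
    using assms that by (intro measurable_compose[OF measurable_component_singleton, of "s ! l"]) auto
  show ?thesis unfolding peeled_def by measurable
qed

lemma sets_residual:
  assumes [measurable]: "\<And>k. k < length s \<Longrightarrow> U k \<in> borel_measurable M"
  shows "residual M U s y \<in> sets M"
  unfolding residual_def by measurable

text \<open>The residual sets are the sections of one measurable subset \<open>S\<close> of the
  product with \<open>M\<close>, and the mass of a section depends measurably on the base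
  point.\<close>

lemma measurable_mass_residual:
  assumes [measurable]: "\<And>k. k < length s \<Longrightarrow> U k \<in> borel_measurable M" and s: "set s \<subseteq> I"
  shows "(\<lambda>y. prob (residual M U s y)) \<in> borel_measurable (PiM I (\<lambda>_. M))"
proof -
  define S where "S = {p \<in> space (PiM I (\<lambda>_. M) \<Otimes>\<^sub>M M). \<forall>k<length s. U k (fst p (s ! k)) < U k (snd p)}"
  have [measurable]: "(\<lambda>p. U k (fst p (s ! k))) \<in> borel_measurable (PiM I (\<lambda>_. M) \<Otimes>\<^sub>M M)"
    if "k < length s" for k
  proof -
    have "(\<lambda>y. y (s ! k)) \<in> measurable (PiM I (\<lambda>_. M)) M"
      using that s by (intro measurable_component_singleton) auto
    then show ?thesis using that assms(1) by measurable
  qed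
  have "S \<in> sets (PiM I (\<lambda>_. M) \<Otimes>\<^sub>M M)" unfolding S_def by measurable
  then have "(\<lambda>y. emeasure M (Pair y -` S)) \<in> borel_measurable (PiM I (\<lambda>_. M))"
    by (rule measurable_emeasure_Pair)
  moreover have "Pair y -` S = residual M U s y" if "y \<in> space (PiM I (\<lambda>_. M))" for y
    using that by (auto simp: S_def residual_def space_pair_measure)
  ultimately have "(\<lambda>y. emeasure M (residual M U s y)) \<in> borel_measurable (PiM I (\<lambda>_. M))"
    by (simp cong: measurable_cong)
  then show ?thesis unfolding measure_def by measurable
qed

text \<open>Each peeling step replaces \<^term>\<open>g j\<close> by its primitive, since the mass of the residual set
  after the step is uniformly distributed below the mass before the step.\<close>

lemma nn_integral_peeled:
  fixes U :: "nat \<Rightarrow> 'a \<Rightarrow> real" and g :: "nat \<Rightarrow> real \<Rightarrow> ennreal"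
  assumes U: "\<And>k. k < length s \<Longrightarrow> U k \<in> borel_measurable M"
    and null: "\<And>k c. k < length s \<Longrightarrow> prob {x \<in> space M. U k x = c} = 0"
    and g: "\<And>j. g j \<in> borel_measurable borel"
    and g_Suc: "\<And>j v. 0 \<le> v \<Longrightarrow> (\<integral>\<^sup>+x. g j x * indicator {0..v} x \<partial>lborel) = g (Suc j) v"
    and "distinct s"
  shows "(\<integral>\<^sup>+y. g j (prob (residual M U s y)) * indicator {y. peeled U s y} y \<partial>PiM (set s) (\<lambda>_. M)) =
    g (j + length s) 1"
  using U null \<open>distinct s\<close>
\<comment> \<open>The point peeled last is integrated out first, since no condition on the earlier
  points involves it. This turns \<open>g j\<close> into \<open>g (Suc j)\<close>, hence the
  arbitrary \<open>j\<close>.\<close>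
proof (induction s arbitrary: j rule: rev_induct)
  case Nil
  interpret product_sigma_finite "\<lambda>_::nat. M" ..
  have "emeasure (PiM {} (\<lambda>_::nat. M)) (space (PiM {} (\<lambda>_. M))) = 1"
    by (intro prob_space.emeasure_space_1 prob_space_PiM prob_space_axioms)
  then show ?case
    by (simp add: peeled_def residual_def prob_space)
next
  case (snoc a s)
  interpret product_sigma_finite "\<lambda>_::nat. M" ..
  let ?n = "length s" and ?R = "residual M U s"
  have a: "a \<notin> set s" and ds: "distinct s" using snoc.prems by auto
  have [measurable]: "U ?n \<in> borel_measurable M" using snoc.prems by auto
  have Um: "\<And>k. k < length s \<Longrightarrow> U k \<in> borel_measurable M" using snoc.prems by auto
  have [measurable]: "\<And>j. g j \<in> borel_measurable borel" by (rule g)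
  have [measurable]: "Measurable.pred (PiM (insert a (set s)) (\<lambda>_. M)) (peeled U (s @ [a]))"
    using snoc.prems by (intro measurable_peeled) auto
  have [measurable]: "(\<lambda>y. prob (residual M U (s @ [a]) y)) \<in> borel_measurable (PiM (insert a (set s)) (\<lambda>_. M))"
    using snoc.prems by (intro measurable_mass_residual) auto
  have "(\<integral>\<^sup>+y. g j (prob (residual M U (s @ [a]) y)) * indicator {y. peeled U (s @ [a]) y} y
        \<partial>PiM (set (s @ [a])) (\<lambda>_. M)) =
      (\<integral>\<^sup>+y. (\<integral>\<^sup>+z. g j (prob (residual M U (s @ [a]) (y(a := z)))) *
        indicator {y. peeled U (s @ [a]) y} (y(a := z)) \<partial>M) \<partial>PiM (set s) (\<lambda>_. M))"
    using a by (simp, subst product_nn_integral_insert) auto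
  also have "\<dots> = (\<integral>\<^sup>+y. g (Suc j) (prob (?R y)) * indicator {y. peeled U s y} y \<partial>PiM (set s) (\<lambda>_. M))"
  proof (rule nn_integral_cong)
    fix y :: "nat \<Rightarrow> 'a"
    have R: "?R y \<in> sets M" using Um by (rule sets_residual)
    have "(\<integral>\<^sup>+z. g j (prob (residual M U (s @ [a]) (y(a := z)))) *
        indicator {y. peeled U (s @ [a]) y} (y(a := z)) \<partial>M) =
      (\<integral>\<^sup>+z. (g j (prob {x \<in> ?R y. U ?n z < U ?n x}) * indicator (?R y) z)
        * indicator {y. peeled U s y} y \<partial>M)"
    proof (rule nn_integral_cong)
      fix z assume "z \<in> space M"
      then have "indicator {y. peeled U (s @ [a]) y} (y(a := z)) =
          (indicator (?R y) z * indicator {y. peeled U s y} y :: ennreal)"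
        using a by (auto simp: peeled_snoc residual_def split: split_indicator)
      then show "g j (prob (residual M U (s @ [a]) (y(a := z)))) *
        indicator {y. peeled U (s @ [a]) y} (y(a := z)) =
        (g j (prob {x \<in> ?R y. U ?n z < U ?n x}) * indicator (?R y) z) * indicator {y. peeled U s y} y"
        using a by (simp add: residual_snoc mult.assoc)
    qed
    also have "\<dots> = (\<integral>\<^sup>+z. g j (prob {x \<in> ?R y. U ?n z < U ?n x}) * indicator (?R y) z \<partial>M)
        * indicator {y. peeled U s y} y"
      by (cases "peeled U s y") auto
    \<comment> \<open>For \<open>z\<close> ranging over \<open>?R y\<close>, the mass left after the
      step is distributed as Lebesgue measure on \<open>{0..prob (?R y)}\<close>;
      \<open>g_Suc\<close> then evaluates the integral.\<close>
    also have "\<dots> = g (Suc j) (prob (?R y)) * indicator {y. peeled U s y} y"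
      using snoc.prems(2)[of ?n] R by (subst set_nn_integral_upper_mass) (auto simp: g_Suc)
    finally show "(\<integral>\<^sup>+z. g j (prob (residual M U (s @ [a]) (y(a := z)))) *
        indicator {y. peeled U (s @ [a]) y} (y(a := z)) \<partial>M) =
      g (Suc j) (prob (?R y)) * indicator {y. peeled U s y} y" .
  qed
  also have "\<dots> = g (Suc j + length s) 1"
    using snoc.prems by (intro snoc.IH) auto
  finally show ?case by simp
qed

text \<open>Given the peeled points, the other \<open>card I - length s\<close> points lie
  independently in a residual set of mass \<open>q\<close>, so all of them do with probability
  \<open>q ^ (card I - length s)\<close>. With the bound \<open>q < c\<close> this is
  \<open>g 0 q\<close>, and \<open>nn_integral_peeled\<close> averages it over the peeled points.
  Keeping \<open>g\<close> abstract separates the probability from the calculus.\<close>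

lemma emeasure_peeled:
  fixes U :: "nat \<Rightarrow> 'a \<Rightarrow> real" and g :: "nat \<Rightarrow> real \<Rightarrow> ennreal"
  assumes U: "\<And>k. k < length s \<Longrightarrow> U k \<in> borel_measurable M"
    and null: "\<And>k c. k < length s \<Longrightarrow> prob {x \<in> space M. U k x = c} = 0"
    and g: "\<And>j. g j \<in> borel_measurable borel"
    and g_Suc: "\<And>j v. 0 \<le> v \<Longrightarrow> (\<integral>\<^sup>+x. g j x * indicator {0..v} x \<partial>lborel) = g (Suc j) v"
    and g_0: "\<And>v. 0 \<le> v \<Longrightarrow> g 0 v = ennreal v ^ (card I - length s) * indicator {..<c} v"
    and s: "distinct s" "set s \<subseteq> I" and I: "finite I"
  shows "{y \<in> space (PiM I (\<lambda>_. M)). peeled U s y \<and> (\<forall>i\<in>I - set s. y i \<in> residual M U s y) \<and>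
      prob (residual M U s y) < c} \<in> sets (PiM I (\<lambda>_. M))" (is "?E \<in> _")
    and "emeasure (PiM I (\<lambda>_. M)) {y \<in> space (PiM I (\<lambda>_. M)). peeled U s y \<and>
      (\<forall>i\<in>I - set s. y i \<in> residual M U s y) \<and> prob (residual M U s y) < c} = g (length s) 1"
proof -
  interpret product_sigma_finite "\<lambda>_::nat. M" ..
  let ?R = "residual M U s" and ?J = "I - set s"
  have IJ: "I = set s \<union> ?J" using s by auto
  have [measurable]: "Measurable.pred (PiM I (\<lambda>_. M)) (peeled U s)"
    using U s by (intro measurable_peeled) auto
  have [measurable]: "(\<lambda>y. prob (?R y)) \<in> borel_measurable (PiM I (\<lambda>_. M))"
    using U s by (intro measurable_mass_residual) auto
  \<comment> \<open>The set \<open>?R y\<close> varies with \<open>y\<close>, so membership is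
    unfolded into finitely many comparisons of coordinates.\<close>
  have mR: "Measurable.pred (PiM I (\<lambda>_. M)) (\<lambda>y. y i \<in> ?R y)" if "i \<in> ?J" for i
  proof -
    have 1: "(\<lambda>y. U k (y l)) \<in> borel_measurable (PiM I (\<lambda>_. M))" if "k < length s" "l \<in> I" for k l
      using U that by (intro measurable_compose[OF measurable_component_singleton, of l]) auto
    have [measurable]: "(\<lambda>y. U k (y (s ! k))) \<in> borel_measurable (PiM I (\<lambda>_. M))"
      "(\<lambda>y. U k (y i)) \<in> borel_measurable (PiM I (\<lambda>_. M))" if "k < length s" for k
      using that s \<open>i \<in> ?J\<close> by (auto intro!: 1)
    have "Measurable.pred (PiM I (\<lambda>_. M)) (\<lambda>y. \<forall>k<length s. U k (y (s ! k)) < U k (y i))"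
      by measurable
    then show ?thesis
      by (rule measurable_cong[THEN iffD1, rotated]) (use that in \<open>auto simp: residual_def space_PiM\<close>)
  qed
  have "Measurable.pred (PiM I (\<lambda>_. M)) (\<lambda>y. \<forall>i\<in>?J. y i \<in> ?R y)"
    using I mR by (intro pred_intros_finite) auto
  note [measurable] = this
  show E: "?E \<in> sets (PiM I (\<lambda>_. M))" by measurable
  have "emeasure (PiM I (\<lambda>_. M)) ?E = (\<integral>\<^sup>+y. indicator ?E y \<partial>PiM (set s \<union> ?J) (\<lambda>_. M))"
    using E IJ by simp
  also have "\<dots> = (\<integral>\<^sup>+x. (\<integral>\<^sup>+z. indicator ?E (merge (set s) ?J (x, z)) \<partial>PiM ?J (\<lambda>_. M)) \<partial>PiM (set s) (\<lambda>_. M))"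
    using E I IJ by (intro product_nn_integral_fold) auto
  also have "\<dots> = (\<integral>\<^sup>+x. g 0 (prob (?R x)) * indicator {y. peeled U s y} x \<partial>PiM (set s) (\<lambda>_. M))"
  proof (rule nn_integral_cong)
    fix x assume x: "x \<in> space (PiM (set s) (\<lambda>_. M))"
    have R: "?R x \<in> sets M" using U by (rule sets_residual)
    have "(\<integral>\<^sup>+z. indicator ?E (merge (set s) ?J (x, z)) \<partial>PiM ?J (\<lambda>_. M)) =
      (\<integral>\<^sup>+z. indicator (PiE ?J (\<lambda>_. ?R x)) z * (indicator {..<c} (prob (?R x)) * indicator {y. peeled U s y} x)
        \<partial>PiM ?J (\<lambda>_. M))"
    proof (rule nn_integral_cong)
      fix z assume z: "z \<in> space (PiM ?J (\<lambda>_. M))"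
      let ?y = "merge (set s) ?J (x, z)"
      have "?y \<in> space (PiM I (\<lambda>_. M))"
        using x z s by (auto simp: space_PiM PiE_iff merge_def extensional_def)
      moreover have "peeled U s ?y = peeled U s x" by (rule peeled_cong) (simp add: merge_def)
      moreover have "?R ?y = ?R x" by (rule residual_cong) (simp add: merge_def)
      moreover have "(\<forall>i\<in>?J. ?y i \<in> ?R x) \<longleftrightarrow> z \<in> PiE ?J (\<lambda>_. ?R x)"
        using z by (auto simp: space_PiM PiE_iff merge_def)
      ultimately show "indicator ?E ?y = (indicator (PiE ?J (\<lambda>_. ?R x)) z *
          (indicator {..<c} (prob (?R x)) * indicator {y. peeled U s y} x) :: ennreal)"
        by (auto split: split_indicator)
    qed
    also have "\<dots> = emeasure (PiM ?J (\<lambda>_. M)) (PiE ?J (\<lambda>_. ?R x)) *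
        (indicator {..<c} (prob (?R x)) * indicator {y. peeled U s y} x)"
      using I R by (subst nn_integral_multc) (auto intro!: sets_PiM_I_finite)
    also have "emeasure (PiM ?J (\<lambda>_. M)) (PiE ?J (\<lambda>_. ?R x)) = ennreal (prob (?R x)) ^ (card I - length s)"
      using I R s by (subst emeasure_PiM) (auto simp: emeasure_eq_measure card_Diff_subset distinct_card)
    finally show "(\<integral>\<^sup>+z. indicator ?E (merge (set s) ?J (x, z)) \<partial>PiM ?J (\<lambda>_. M)) =
      g 0 (prob (?R x)) * indicator {y. peeled U s y} x"
      by (simp add: g_0 mult.assoc)
  qed
  also have "\<dots> = g (0 + length s) 1"
    using assms by (intro nn_integral_peeled) auto
  finally show "emeasure (PiM I (\<lambda>_. M)) ?E = g (length s) 1" by simp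
qed

text \<open>With all coordinates but \<open>j\<close> fixed, a tie forces coordinate
  \<open>j\<close> into a single level set of \<open>U\<close>, which is null; Fubini
  finishes.\<close>

lemma AE_PiM_neq:
  fixes U :: "'a \<Rightarrow> real"
  assumes U [measurable]: "U \<in> borel_measurable M"
    and null: "\<And>c. prob {x \<in> space M. U x = c} = 0"
    and I: "finite I" "i \<in> I" "j \<in> I" "i \<noteq> j"
  shows "AE y in PiM I (\<lambda>_. M). U (y i) \<noteq> U (y j)"
proof -
  interpret product_sigma_finite "\<lambda>_::'i. M" ..
  let ?K = "I - {j}"
  have IK: "I = insert j ?K" using I by auto
  have [measurable]: "(\<lambda>y. y i) \<in> measurable (PiM I (\<lambda>_. M)) M" "(\<lambda>y. y j) \<in> measurable (PiM I (\<lambda>_. M)) M"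
    using I by auto
  let ?E = "{y \<in> space (PiM I (\<lambda>_. M)). U (y i) = U (y j)}"
  have E: "?E \<in> sets (PiM I (\<lambda>_. M))" by measurable
  have "emeasure (PiM I (\<lambda>_. M)) ?E = (\<integral>\<^sup>+y. indicator ?E y \<partial>PiM (insert j ?K) (\<lambda>_. M))"
    using E IK by simp
  also have "\<dots> = (\<integral>\<^sup>+x. (\<integral>\<^sup>+z. indicator ?E (x(j := z)) \<partial>M) \<partial>PiM ?K (\<lambda>_. M))"
    using E I IK by (intro product_nn_integral_insert) auto
  also have "\<dots> = (\<integral>\<^sup>+x. 0 \<partial>PiM ?K (\<lambda>_. M))"
  proof (rule nn_integral_cong)
    fix x assume "x \<in> space (PiM ?K (\<lambda>_. M))"
    have "(\<integral>\<^sup>+z. indicator ?E (x(j := z)) \<partial>M) \<le> (\<integral>\<^sup>+z. indicator {z \<in> space M. U z = U (x i)} z \<partial>M)"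
      using I by (intro nn_integral_mono) (auto split: split_indicator)
    also have "\<dots> = 0" using null[of "U (x i)"] by (simp add: emeasure_eq_measure)
    finally show "(\<integral>\<^sup>+z. indicator ?E (x(j := z)) \<partial>M) = 0" by simp
  qed
  finally have "emeasure (PiM I (\<lambda>_. M)) ?E = 0" by simp
  then show ?thesis using E by (intro AE_I[of _ _ ?E]) auto
qed

end

section \<open>Iterated primitives of a truncated power\<close>

text \<open>On nonnegative \<open>v\<close> this is the \<open>j\<close>-th iterated primitive, from
  0, of \<open>v ^ p\<close> cut off at \<open>c\<close>. From \<open>c\<close> on its
  \<open>j\<close>-th derivative is 0, so it is its Taylor polynomial at \<open>c\<close>, with
  coefficients read off from the left branch. For \<open>j = 0\<close> the sum is empty, which gives
  the cutoff.\<close>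

definition peel_density :: "nat \<Rightarrow> real \<Rightarrow> nat \<Rightarrow> real \<Rightarrow> real" where
  "peel_density p c j v = (if v < c then fact p / fact (p + j) * v ^ (p + j)
    else (\<Sum>k<j. fact p / (fact (p + j - k) * fact k) * c ^ (p + j - k) * (v - c) ^ k))"

lemma peel_density_measurable [measurable]: "peel_density p c j \<in> borel_measurable borel"
  unfolding peel_density_def by measurable

lemma peel_density_nonneg: "0 \<le> c \<Longrightarrow> 0 \<le> v \<Longrightarrow> 0 \<le> peel_density p c j v"
  unfolding peel_density_def by (auto intro!: sum_nonneg)

text \<open>Both branches differentiate to the corresponding branch one index lower, and the
  branches of index \<open>Suc j\<close> agree at \<open>c\<close>. So the fundamental theorem of
  calculus applies on each side of \<open>c\<close> and the pieces join.\<close>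

lemma nn_integral_peel_density:
  assumes "0 \<le> c" "0 \<le> v"
  shows "(\<integral>\<^sup>+x. ennreal (peel_density p c j x) * indicator {0..v} x \<partial>lborel) = ennreal (peel_density p c (Suc j) v)"
proof -
  define f where "f j x = fact p / fact (p + j) * x ^ (p + j)" for j and x :: real
  define h where "h j x = (\<Sum>k<j. fact p / (fact (p + j - k) * fact k) * c ^ (p + j - k) * (x - c) ^ k)"
    for j and x :: real
  have pd: "peel_density p c j x = (if x < c then f j x else h j x)" for j x
    by (simp add: peel_density_def f_def h_def)
  have [measurable]: "f j \<in> borel_measurable borel" "h j \<in> borel_measurable borel" for j
    unfolding f_def h_def by measurable
  have df: "(f (Suc j) has_real_derivative f j x) (at x)" for x
    unfolding f_def
    by (rule derivative_eq_intros refl | simp)+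
  have dh: "(h (Suc j) has_real_derivative h j x) (at x)" for x
  proof -
    have "((\<lambda>x. \<Sum>k<Suc j. fact p / (fact (p + Suc j - k) * fact k) * c ^ (p + Suc j - k) * (x - c) ^ k)
        has_real_derivative (\<Sum>k<Suc j. fact p / (fact (p + Suc j - k) * fact k) * c ^ (p + Suc j - k) *
          (real k * (x - c) ^ (k - 1)))) (at x)"
      by (intro DERIV_sum DERIV_cmult) (auto intro!: derivative_eq_intros)
    \<comment> \<open>The summand \<open>k = 0\<close> is constant; in the others an index shift
      cancels \<open>real k\<close> against the factorial.\<close>
    also have "(\<Sum>k<Suc j. fact p / (fact (p + Suc j - k) * fact k) * c ^ (p + Suc j - k) *
          (real k * (x - c) ^ (k - 1))) = h j x"
      unfolding h_def
      by (subst sum.lessThan_Suc_shift) (auto intro!: sum.cong simp: divide_simps)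
    finally show ?thesis unfolding h_def .
  qed
  have f_ge: "0 \<le> f j x" if "0 \<le> x" for j x using that by (simp add: f_def)
  have h_ge: "0 \<le> h j x" if "c \<le> x" for j x
    using that \<open>0 \<le> c\<close> unfolding h_def by (intro sum_nonneg) auto
  have f0: "f (Suc j) 0 = 0" by (simp add: f_def)
  have hc: "h (Suc j) c = f (Suc j) c"
    unfolding h_def f_def by (subst sum.lessThan_Suc_shift) simp
  have int_f: "(\<integral>\<^sup>+x. ennreal (f j x) * indicator {0..u} x \<partial>lborel) = ennreal (f (Suc j) u)" if "0 \<le> u" for u
    using nn_integral_FTC_Icc[of "f j" 0 u "f (Suc j)"] df f_ge that f0 by simp
  show ?thesis
  proof (cases "v < c")
    case True
    then have "(\<integral>\<^sup>+x. ennreal (peel_density p c j x) * indicator {0..v} x \<partial>lborel) =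
        (\<integral>\<^sup>+x. ennreal (f j x) * indicator {0..v} x \<partial>lborel)"
      by (intro nn_integral_cong) (auto simp: pd split: split_indicator)
    then show ?thesis using True int_f[OF \<open>0 \<le> v\<close>] by (simp add: pd)
  next
    case False
    \<comment> \<open>Both intervals contain \<open>c\<close>, so the integrands are compared away
      from this null point.\<close>
    have "AE x in lborel. x \<noteq> c" by (rule AE_lborel_singleton)
    then have "(\<integral>\<^sup>+x. ennreal (peel_density p c j x) * indicator {0..v} x \<partial>lborel) =
        (\<integral>\<^sup>+x. ennreal (f j x) * indicator {0..c} x + ennreal (h j x) * indicator {c..v} x \<partial>lborel)"
      using False \<open>0 \<le> c\<close> by (intro nn_integral_cong_AE) (auto simp: pd split: split_indicator)
    also have "\<dots> = ennreal (f (Suc j) c) + ennreal (h (Suc j) v - h (Suc j) c)"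
      using nn_integral_FTC_Icc[of "h j" c v "h (Suc j)"] dh h_ge False int_f[OF \<open>0 \<le> c\<close>]
      by (subst nn_integral_add) auto
    also have "\<dots> = ennreal (h (Suc j) v)"
    proof -
      \<comment> \<open>\<open>ennreal\<close> sends negative reals to 0, so the difference must be
        nonnegative before \<open>h (Suc j) c\<close> can be added back.\<close>
      have "h (Suc j) c \<le> h (Suc j) v"
        using False dh h_ge by (intro DERIV_nonneg_imp_nondecreasing[of c v "h (Suc j)"]) auto
      then show ?thesis using hc f_ge[OF \<open>0 \<le> c\<close>] by (subst ennreal_plus[symmetric]) auto
    qed
    finally show ?thesis using False by (simp add: pd)
  qed
qed

text \<open>With \<open>p = N - m\<close> and \<open>j = m\<close> the exponent
  \<open>p + j - k\<close> is \<open>N - k\<close>, and the number \<open>N! / (N - m)!\<close> of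
  peeling orders cancels \<open>p!\<close>, leaving binomial coefficients. As
  \<open>c \<le> 1\<close>, the polynomial branch applies at 1.\<close>

lemma fact_mult_peel_density:
  assumes "m \<le> N" "c \<le> 1"
  shows "fact N / fact (N - m) * peel_density (N - m) c m 1 =
    (\<Sum>k<m. real (N choose k) * (1 - c) ^ k * c ^ (N - k))"
proof -
  have "fact N / fact (N - m) * peel_density (N - m) c m 1 =
      (\<Sum>k<m. fact N / fact (N - m) * (fact (N - m) / (fact (N - k) * fact k) * c ^ (N - k) * (1 - c) ^ k))"
    using assms by (simp add: peel_density_def sum_distrib_left)
  also have "\<dots> = (\<Sum>k<m. real (N choose k) * (1 - c) ^ k * c ^ (N - k))"
    using assms(1) by (intro sum.cong) (auto simp: binomial_fact mult_ac)
  finally show ?thesis .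
qed

context prob_space
begin

text \<open>The union bound is lossless here: up to a null set of ties, the events for different peeling
  orders \<^term>\<open>s\<close> are disjoint.\<close>

lemma emeasure_Union_peeled_le:
  fixes U :: "nat \<Rightarrow> 'a \<Rightarrow> real"
  assumes U: "\<And>k. k < m \<Longrightarrow> U k \<in> borel_measurable M"
    and null: "\<And>k c. k < m \<Longrightarrow> prob {x \<in> space M. U k x = c} = 0"
    and c: "0 \<le> c" "c \<le> 1" and I: "finite I" "m \<le> card I"
  shows "(\<Union>s\<in>{s. length s = m \<and> distinct s \<and> set s \<subseteq> I}.
      {y \<in> space (PiM I (\<lambda>_. M)). peeled U s y \<and> (\<forall>i\<in>I - set s. y i \<in> residual M U s y) \<and>
        prob (residual M U s y) < c}) \<in> sets (PiM I (\<lambda>_. M))" (is "(\<Union>s\<in>?L. ?E s) \<in> _")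
    and "emeasure (PiM I (\<lambda>_. M)) (\<Union>s\<in>{s. length s = m \<and> distinct s \<and> set s \<subseteq> I}.
      {y \<in> space (PiM I (\<lambda>_. M)). peeled U s y \<and> (\<forall>i\<in>I - set s. y i \<in> residual M U s y) \<and>
        prob (residual M U s y) < c})
      \<le> ennreal (\<Sum>k<m. real (card I choose k) * (1 - c) ^ k * c ^ (card I - k))"
proof -
  let ?g = "\<lambda>j v. ennreal (peel_density (card I - m) c j v)"
  have E: "?E s \<in> sets (PiM I (\<lambda>_. M))" "emeasure (PiM I (\<lambda>_. M)) (?E s) = ?g m 1" if "s \<in> ?L" for s
  proof -
    have "?g 0 v = ennreal v ^ (card I - length s) * indicator {..<c} v" if "0 \<le> v" for v
      using that \<open>s \<in> ?L\<close> by (auto simp: peel_density_def ennreal_power split: split_indicator)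
    then have "?E s \<in> sets (PiM I (\<lambda>_. M)) \<and> emeasure (PiM I (\<lambda>_. M)) (?E s) = ?g (length s) 1"
      using that U null c I nn_integral_peel_density
      by (intro conjI emeasure_peeled[where g = ?g]) auto
    then show "?E s \<in> sets (PiM I (\<lambda>_. M))" "emeasure (PiM I (\<lambda>_. M)) (?E s) = ?g m 1"
      using that by auto
  qed
  have fin: "finite ?L"
    by (rule finite_subset[OF _ finite_lists_length_eq[OF \<open>finite I\<close>, of m]]) auto
  show "(\<Union>s\<in>?L. ?E s) \<in> sets (PiM I (\<lambda>_. M))" using E(1) fin by (intro sets.finite_UN) auto
  have "emeasure (PiM I (\<lambda>_. M)) (\<Union>s\<in>?L. ?E s) \<le> (\<Sum>s\<in>?L. emeasure (PiM I (\<lambda>_. M)) (?E s))"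
    using E(1) fin by (intro emeasure_subadditive_finite) auto
  also have "\<dots> = of_nat (card ?L) * ?g m 1" using E(2) by simp
  also have "card ?L = fact (card I) div fact (card I - m)"
    using I by (simp add: card_lists_distinct_length_eq fact_div_fact)
  also have "of_nat (fact (card I) div fact (card I - m)) * ?g m 1 =
      ennreal (fact (card I) / fact (card I - m) * peel_density (card I - m) c m 1)"
  proof -
    have "real (fact (card I) div fact (card I - m)) = fact (card I) / fact (card I - m)"
      using I by (simp add: real_of_nat_div fact_dvd)
    then show ?thesis
      by (subst ennreal_of_nat_eq_real_of_nat, subst ennreal_mult''[symmetric]) (auto intro!: peel_density_nonneg c)
  qed
  also have "\<dots> = ennreal (\<Sum>k<m. real (card I choose k) * (1 - c) ^ k * c ^ (card I - k))"
    using fact_mult_peel_density[OF I(2) c(2)] by simp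
  finally show "emeasure (PiM I (\<lambda>_. M)) (\<Union>s\<in>?L. ?E s)
      \<le> ennreal (\<Sum>k<m. real (card I choose k) * (1 - c) ^ k * c ^ (card I - k))" .
qed

end

subsection \<open>Total preorders on a probability space\<close>

lemma ordered_spaceD:
  assumes "ordered_space Q m le" "k \<in> {1..m}"
  shows "x \<in> space Q \<Longrightarrow> le k x x"
    and "\<lbrakk>x \<in> space Q; y \<in> space Q; z \<in> space Q; le k x y; le k y z\<rbrakk> \<Longrightarrow> le k x z"
    and "\<lbrakk>x \<in> space Q; y \<in> space Q\<rbrakk> \<Longrightarrow> le k x y \<or> le k y x"
    and "x \<in> space Q \<Longrightarrow> {y \<in> space Q. eqr le k y x} \<in> sets Q"
    and "x \<in> space Q \<Longrightarrow> {y \<in> space Q. le k y x} \<in> sets Q"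
  using assms unfolding ordered_space_def by blast+

text \<open>\<open>ordered_space\<close> provides lower sets and tie classes. By totality, the
  complement of an upper set is the lower set of \<open>x\<close> without its tie class.\<close>

lemma sets_upper:
  assumes "ordered_space Q m le" "k \<in> {1..m}" "x \<in> space Q"
  shows "{y \<in> space Q. le k x y} \<in> sets Q"
proof -
  note o = ordered_spaceD[OF assms(1,2)]
  have "{y \<in> space Q. le k x y} = space Q - ({y \<in> space Q. le k y x} - {y \<in> space Q. eqr le k y x})"
    using o(3) assms(3) by (auto simp: eqr_def)
  then show ?thesis using o(4,5) assms(3) by auto
qed

context prob_space
begin

lemma Sfun_antimono:
  assumes "ordered_space M m le" "k \<in> {1..m}" "x \<in> space M" "y \<in> space M" "le k x y"
  shows "Sfun M le k y \<le> Sfun M le k x"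
  unfolding Sfun_def using ordered_spaceD(2)[OF assms(1,2)] sets_upper[OF assms(1,2)] assms(3-)
  by (intro finite_measure_mono) blast+

lemma Sfun_bounds: "0 \<le> Sfun M le k x" "Sfun M le k x \<le> 1"
  by (simp_all add: Sfun_def)

text \<open>An interval between two points of a level set is null, up to the tie class of its upper
  end, so (A4) forbids a level set of positive measure.\<close>

lemma Sfun_level_null:
  assumes o: "ordered_space M m le" and k: "k \<in> {1..m}" and A4: "condA4 M m le" and A3: "condA3 M m le"
    and ties: "\<And>x. x \<in> space M \<Longrightarrow> prob {y \<in> space M. eqr le k y x} = 0"
  shows "prob {y \<in> space M. Sfun M le k y = \<beta>} = 0"
proof (cases "\<beta> \<in> {0..1}")
  \<comment> \<open>(A3) speaks only of levels in the unit interval; the other level sets are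
    empty.\<close>
  case False
  then have "{y \<in> space M. Sfun M le k y = \<beta>} = {}" using Sfun_bounds by auto
  then show ?thesis by (metis measure_empty)
next
  case True
  define Z where "Z = {y \<in> space M. Sfun M le k y = \<beta>}"
  have Z: "Z \<in> sets M" using A3 k True by (auto simp: condA3_def Z_def)
  show ?thesis
  proof (rule ccontr)
    assume "prob {y \<in> space M. Sfun M le k y = \<beta>} \<noteq> 0"
    then have pos: "prob Z > 0" by (simp add: Z_def zero_less_measure_iff)
    then have "Z \<noteq> {}" by auto
    have "prob {z \<in> Z. le k p z \<and> le k z q} = 0" if "p \<in> Z" "q \<in> Z" for p q
    proof (cases "le k p q")
      case False
      then have "{z \<in> Z. le k p z \<and> le k z q} = {}"
        using that ordered_spaceD(2)[OF o k] by (auto simp: Z_def)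
      then show ?thesis by (metis measure_empty)
    next
      case True
      have pq: "p \<in> space M" "q \<in> space M" "Sfun M le k p = \<beta>" "Sfun M le k q = \<beta>"
        using that by (auto simp: Z_def)
      have sub: "{z \<in> space M. le k q z} \<subseteq> {z \<in> space M. le k p z}"
        using True pq ordered_spaceD(2)[OF o k] by blast
      have "{z \<in> Z. le k p z \<and> le k z q} \<subseteq>
          ({z \<in> space M. le k p z} - {z \<in> space M. le k q z}) \<union> {z \<in> space M. eqr le k z q}"
        by (auto simp: Z_def eqr_def)
      then have "prob {z \<in> Z. le k p z \<and> le k z q} \<le>
          prob (({z \<in> space M. le k p z} - {z \<in> space M. le k q z}) \<union> {z \<in> space M. eqr le k z q})"
        using pq sets_upper[OF o k] ordered_spaceD(4)[OF o k] by (intro finite_measure_mono) auto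
      also have "\<dots> \<le> prob ({z \<in> space M. le k p z} - {z \<in> space M. le k q z}) + prob {z \<in> space M. eqr le k z q}"
        using pq sets_upper[OF o k] ordered_spaceD(4)[OF o k] by (intro measure_Un_le) auto
      \<comment> \<open>The upper sets are nested, so masses subtract; on a level set the difference
        is 0.\<close>
      also have "\<dots> = Sfun M le k p - Sfun M le k q"
        using pq sets_upper[OF o k] sub ties by (simp add: finite_measure_Diff Sfun_def)
      finally show ?thesis using pq by (simp add: measure_le_0_iff)
    qed
    then have "(SUP p\<in>Z \<times> Z. prob {z \<in> Z. le k (fst p) z \<and> le k z (snd p)}) = (SUP p\<in>Z \<times> Z. 0)"
      by (intro SUP_cong) auto
    \<comment> \<open>Nonemptiness of \<open>Z\<close> matters, since a real supremum over the empty
      set is a mere default value.\<close>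
    also have "\<dots> = 0" using \<open>Z \<noteq> {}\<close> by (intro cSUP_const) auto
    finally show False using A4 k Z pos by (force simp: condA4_def)
  qed
qed

text \<open>A superlevel set \<open>L\<close> is closed downwards. If \<open>Sfun\<close> attains
  its infimum \<open>\<gamma>\<close> over \<open>L\<close> at \<open>x\<close>, then
  \<open>L\<close> is the lower set of \<open>x\<close> together with the level set of
  \<open>\<gamma>\<close>, measurable by (A3). Otherwise a nonempty \<open>L\<close> is the union of
  the lower sets of countably many points whose values approach \<open>\<gamma>\<close>.\<close>

lemma measurable_Sfun:
  assumes o: "ordered_space M m le" and k: "k \<in> {1..m}" and A3: "condA3 M m le"
  shows "Sfun M le k \<in> borel_measurable M"
  unfolding borel_measurable_iff_ge
proof
  fix \<beta>
  define L where "L = {y \<in> space M. \<beta> \<le> Sfun M le k y}"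
  define \<gamma> where "\<gamma> = Inf (Sfun M le k ` L)"
  have bdd: "bdd_below (Sfun M le k ` L)" using Sfun_bounds by (intro bdd_belowI[of _ 0]) auto
  have \<gamma>_le: "\<gamma> \<le> Sfun M le k y" if "y \<in> L" for y
    using bdd that unfolding \<gamma>_def by (intro cINF_lower) auto
  have low: "y \<in> L" if "x \<in> L" "y \<in> space M" "le k y x" for x y
    using that Sfun_antimono[OF o k, of y x] by (auto simp: L_def)
  have up: "le k y x" if "x \<in> L" "y \<in> space M" "Sfun M le k x < Sfun M le k y" for x y
    using that Sfun_antimono[OF o k, of x y] ordered_spaceD(3)[OF o k, of x y] by (auto simp: L_def)
  have "L \<in> sets M"
  proof (cases "\<exists>x\<in>L. Sfun M le k x = \<gamma>")
    case True
    then obtain x where x: "x \<in> L" "Sfun M le k x = \<gamma>" by blast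
    \<comment> \<open>Points strictly above \<open>x\<close> may share its value, hence the level
      set; a larger value puts a point below \<open>x\<close>.\<close>
    have "L = {y \<in> space M. le k y x} \<union> {y \<in> space M. Sfun M le k y = \<gamma>}"
    proof (intro set_eqI iffI)
      fix y assume "y \<in> L"
      then show "y \<in> {y \<in> space M. le k y x} \<union> {y \<in> space M. Sfun M le k y = \<gamma>}"
        using \<gamma>_le[of y] up[OF x(1), of y] x(2) by (force simp: L_def)
    qed (use x low in \<open>auto simp: L_def\<close>)
    moreover have "{y \<in> space M. Sfun M le k y = \<gamma>} \<in> sets M"
      using A3 k Sfun_bounds[of le k x] x by (auto simp: condA3_def)
    ultimately show ?thesis using ordered_spaceD(5)[OF o k] x by (auto simp: L_def)
  next
    case False
    show ?thesis
    proof (cases "L = {}")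
      case nonempty: False
      have "\<exists>x\<in>L. Sfun M le k x < \<gamma> + 1 / real (Suc n)" for n
        using nonempty bdd cINF_less_iff[of L "Sfun M le k" "\<gamma> + 1 / real (Suc n)"]
        by (simp add: \<gamma>_def)
      then obtain f where f: "\<And>n. f n \<in> L" "\<And>n. Sfun M le k (f n) < \<gamma> + 1 / real (Suc n)"
        by metis
      have "L = (\<Union>n. {y \<in> space M. le k y (f n)})"
      proof (intro set_eqI iffI)
        fix y assume y: "y \<in> L"
        then have "0 < Sfun M le k y - \<gamma>" using \<gamma>_le[OF y] False by force
        then obtain n where "1 / real (Suc n) < Sfun M le k y - \<gamma>" using nat_approx_posE by blast
        then have "Sfun M le k (f n) < Sfun M le k y" using f(2)[of n] by simp
        then show "y \<in> (\<Union>n. {y \<in> space M. le k y (f n)})" using up[OF f(1)] y by (auto simp: L_def)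
      qed (use f low in auto)
      moreover have "f n \<in> space M" for n using f(1) by (auto simp: L_def)
      ultimately show ?thesis using ordered_spaceD(5)[OF o k] by auto
    qed simp
  qed
  then show "{w \<in> space M. \<beta> \<le> Sfun M le k w} \<in> sets M" by (simp add: L_def)
qed

end

subsection \<open>The extended space\<close>

lemma space_ext: "space (ext_space P) = space P \<times> {0..1}"
  by (simp add: ext_space_def space_pair_measure space_restrict_space)

lemma prob_space_restrict_lebesgue: "prob_space (restrict_space lebesgue {0..1::real})"
  by (intro prob_space_restrict_space) auto

lemma prob_space_ext: "prob_space P \<Longrightarrow> prob_space (ext_space P)"
  unfolding ext_space_def by (rule prob_space_pair[OF _ prob_space_restrict_lebesgue])

lemma sets_restrict_lebesgue:
  "B \<in> sets borel \<Longrightarrow> {t \<in> {0..1}. t \<in> B} \<in> sets (restrict_space lebesgue {0..1::real})"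
  by (auto simp: sets_restrict_space_iff Collect_conj_eq intro: sets_completionI_sets)

text \<open>Second coordinates are compared only within a tie class of the first, so tie classes and
  lower sets of the extended order are finite unions of measurable rectangles.\<close>

lemma ordered_space_ext:
  assumes o: "ordered_space P m le"
  shows "ordered_space (ext_space P) m (ext_rel le)"
proof -
  have times: "A \<times> {t \<in> {0..1}. t \<in> B} \<in> sets (ext_space P)" if "A \<in> sets P" "B \<in> sets borel" for A B
    using that sets_restrict_lebesgue unfolding ext_space_def by (intro pair_measureI) auto
  show ?thesis
    unfolding ordered_space_def
  proof (intro ballI conjI impI)
    fix k x assume k: "k \<in> {1..m}" and x: "x \<in> space (ext_space P)"
    note ok = ordered_spaceD[OF o k]
    have x': "fst x \<in> space P" using x by (auto simp: space_ext)
    show "ext_rel le k x x" using ok(1) x' by (auto simp: ext_rel_def eqr_def)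
    have "{y \<in> space (ext_space P). eqr (ext_rel le) k y x} =
        {y \<in> space P. eqr le k y (fst x)} \<times> {t \<in> {0..1}. t \<in> {snd x}}"
      using x by (auto simp: space_ext ext_rel_def eqr_def ltr_def)
    then show "{y \<in> space (ext_space P). eqr (ext_rel le) k y x} \<in> sets (ext_space P)"
      using times[OF ok(4)[OF x'], of "{snd x}"] by simp
    have "{y \<in> space (ext_space P). ext_rel le k y x} =
        ({y \<in> space P. le k y (fst x)} - {y \<in> space P. eqr le k y (fst x)}) \<times> {t \<in> {0..1}. t \<in> UNIV}
        \<union> {y \<in> space P. eqr le k y (fst x)} \<times> {t \<in> {0..1}. t \<in> {..snd x}}"
      by (auto simp: space_ext ext_rel_def ltr_def)
    then show "{y \<in> space (ext_space P). ext_rel le k y x} \<in> sets (ext_space P)"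
      using times[OF ok(4)[OF x'], of "{..snd x}"]
        times[OF sets.Diff[OF ok(5)[OF x'] ok(4)[OF x']], of UNIV] by auto
    fix y assume y: "y \<in> space (ext_space P)"
    have y': "fst y \<in> space P" using y by (auto simp: space_ext)
    show "ext_rel le k x y \<or> ext_rel le k y x"
      using ok(3)[OF x' y'] by (auto simp: ext_rel_def eqr_def ltr_def)
    fix z assume z: "z \<in> space (ext_space P)" and xy: "ext_rel le k x y" and yz: "ext_rel le k y z"
    have z': "fst z \<in> space P" using z by (auto simp: space_ext)
    show "ext_rel le k x z"
      using xy yz ok(2)[OF x' y' z'] ok(2)[OF z' y' x'] ok(2)[OF y' z' x'] ok(2)[OF z' x' y']
      by (auto simp: ext_rel_def eqr_def ltr_def)
  qed
qed

text \<open>A tie class of the extended order fixes the second coordinate, and single points are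
  Lebesgue null.\<close>

lemma ext_ties_null:
  assumes P: "prob_space P" and o: "ordered_space P m le" and k: "k \<in> {1..m}" and x: "x \<in> space (ext_space P)"
  shows "measure (ext_space P) {y \<in> space (ext_space P). eqr (ext_rel le) k y x} = 0"
proof -
  interpret L: prob_space "restrict_space lebesgue {0..1::real}" by (rule prob_space_restrict_lebesgue)
  have x': "fst x \<in> space P" using x by (auto simp: space_ext)
  have "{y \<in> space (ext_space P). eqr (ext_rel le) k y x} =
      {y \<in> space P. eqr le k y (fst x)} \<times> {t \<in> {0..1}. t \<in> {snd x}}"
    using x by (auto simp: space_ext ext_rel_def eqr_def ltr_def)
  moreover have "emeasure (restrict_space lebesgue {0..1::real}) {t \<in> {0..1}. t \<in> {snd x}} = 0"
  proof -
    have "{t \<in> {0..1}. t \<in> {snd x}} = {snd x}" using x by (auto simp: space_ext)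
    then show ?thesis using x by (subst emeasure_restrict_space) (auto simp: space_ext)
  qed
  moreover have "emeasure (ext_space P) ({y \<in> space P. eqr le k y (fst x)} \<times> {t \<in> {0..1}. t \<in> {snd x}}) =
    emeasure P {y \<in> space P. eqr le k y (fst x)} *
    emeasure (restrict_space lebesgue {0..1::real}) {t \<in> {0..1}. t \<in> {snd x}}"
    unfolding ext_space_def using ordered_spaceD(4)[OF o k x']
    by (intro L.emeasure_pair_measure_Times sets_restrict_lebesgue) auto
  ultimately show ?thesis by (simp add: measure_def)
qed

section \<open>Sample minima and the existence of a peeling order\<close>

lemma ex_min_total_preorder:
  assumes "finite A" "A \<noteq> {}" "\<And>x y. x \<in> A \<Longrightarrow> y \<in> A \<Longrightarrow> R x y \<or> R y x"
    and "\<And>x y z. \<lbrakk>x \<in> A; y \<in> A; z \<in> A; R x y; R y z\<rbrakk> \<Longrightarrow> R x z"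
  shows "\<exists>y\<in>A. \<forall>x\<in>A. R y x"
  using assms
proof (induction A rule: finite_ne_induct)
  case (insert a A)
  have "\<exists>y\<in>A. \<forall>x\<in>A. R y x"
    using insert.prems by (intro insert.IH) blast+
  then obtain y where y: "y \<in> A" "\<forall>x\<in>A. R y x" by blast
  show ?case
  proof (cases "R y a")
    case False
    then have "R a y" "R a a" using insert.prems(1) y(1) by blast+
    then have "\<forall>x\<in>insert a A. R a x" using y insert.prems(2)[of a y] by blast
    then show ?thesis by blast
  qed (use y in blast)
qed blast

text \<open>A finite nonempty sample has a minimum, so the choice in \<open>hmin\<close> does pick
  one.\<close>

lemma hmin_props:
  assumes o: "ordered_space P m le" and k: "k \<in> {1..m}" and "1 \<le> N" and x: "\<And>i. i \<in> {1..N} \<Longrightarrow> x i \<in> space P"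
  shows "hmin le N k x \<in> space P" and "\<And>i. i \<in> {1..N} \<Longrightarrow> le k (hmin le N k x) (x i)"
proof -
  have sub: "x ` {1..N} \<subseteq> space P" using x by blast
  have "\<exists>y\<in>x ` {1..N}. \<forall>z\<in>x ` {1..N}. le k y z"
  proof (rule ex_min_total_preorder)
    show "x ` {1..N} \<noteq> {}" using \<open>1 \<le> N\<close> by simp
    show "le k u v \<or> le k v u" if "u \<in> x ` {1..N}" "v \<in> x ` {1..N}" for u v
      using that sub ordered_spaceD(3)[OF o k] by (meson subsetD)
    show "le k u w" if "u \<in> x ` {1..N}" "v \<in> x ` {1..N}" "w \<in> x ` {1..N}" "le k u v" "le k v w" for u v w
      using that sub ordered_spaceD(2)[OF o k, of u v w] by (meson subsetD)
  qed simp
  then have "\<exists>y. y \<in> x ` {1..N} \<and> (\<forall>i\<in>{1..N}. le k y (x i))" by blast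
  from someI_ex[OF this] show "hmin le N k x \<in> space P" "\<And>i. i \<in> {1..N} \<Longrightarrow> le k (hmin le N k x) (x i)"
    unfolding hmin_def[symmetric] using x by auto
qed

text \<open>The first \<open>m\<close> values of the permutation behind \<open>tilde\<close> form a
  peeling order: minimality gives weak inequalities for \<open>U\<close>, and \<open>neq\<close>
  makes them strict. A residual point projects to a point above every \<open>hmin\<close>, so the
  residual set sits over the set that defines \<open>Dfun\<close>.\<close>

lemma ex_peeling_order:
  fixes P :: "'a measure"
  assumes P: "prob_space P" and o: "ordered_space P m le" and "m \<le> N"
    and tilde: "valid_tilde (ext_space P) m (ext_rel le) N tilde"
    and U: "U = (\<lambda>k y. - Sfun (ext_space P) (ext_rel le) (Suc k) y)"
    and y: "y \<in> PiE {1..N} (\<lambda>_. space (ext_space P))"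
    and neq: "\<And>k i j. \<lbrakk>k < m; i \<in> {1..N}; j \<in> {1..N}; i \<noteq> j\<rbrakk> \<Longrightarrow> U k (y i) \<noteq> U k (y j)"
  shows "\<exists>s. length s = m \<and> distinct s \<and> set s \<subseteq> {1..N} \<and> peeled U s y \<and>
    (\<forall>i\<in>{1..N} - set s. y i \<in> residual (ext_space P) U s y) \<and>
    measure (ext_space P) (residual (ext_space P) U s y) \<le> Dfun P m le N (compose {1..N} fst y)"
proof -
  let ?Q = "ext_space P" and ?x = "compose {1..N} fst y"
  interpret P: prob_space P by (rule P)
  interpret Q: prob_space ?Q by (rule prob_space_ext[OF P])
  interpret L: prob_space "restrict_space lebesgue {0..1::real}" by (rule prob_space_restrict_lebesgue)
  note oQ = ordered_space_ext[OF o]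
  obtain \<pi> where \<pi>: "\<pi> permutes {1..N}" "\<And>i. i \<in> {1..N} \<Longrightarrow> tilde y i = y (\<pi> i)"
    and min: "\<And>k i. \<lbrakk>k \<in> {1..m}; k \<le> i; i \<le> N\<rbrakk> \<Longrightarrow> ext_rel le k (tilde y k) (tilde y i)"
    using tilde y unfolding valid_tilde_def by blast
  \<comment> \<open>List positions count from 0, while orders and entries of \<open>tilde\<close>
    count from 1.\<close>
  define s where "s = map \<pi> [1..<Suc m]"
  have len: "length s = m" by (simp add: s_def)
  have nth: "s ! k = \<pi> (Suc k)" if "k < m" for k using that by (simp add: s_def del: upt_Suc)
  have set_s: "set s = \<pi> ` {1..m}" by (simp add: s_def atLeastLessThanSuc_atLeastAtMost del: upt_Suc)
  have inj: "inj \<pi>" using \<pi>(1) by (rule permutes_inj)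
  have \<pi>_in: "\<pi> i \<in> {1..N}" if "i \<in> {1..N}" for i using that permutes_in_image[OF \<pi>(1)] by blast
  have y_in: "y i \<in> space ?Q" if "i \<in> {1..N}" for i using y that by auto
  have less: "U k (y (\<pi> (Suc k))) < U k (y (\<pi> i))" if "k < m" "Suc k < i" "i \<le> N" for k i
  proof -
    have i: "i \<in> {1..N}" "Suc k \<in> {1..N}" "Suc k \<in> {1..m}" using that \<open>m \<le> N\<close> by auto
    have "ext_rel le (Suc k) (y (\<pi> (Suc k))) (y (\<pi> i))"
      using min[of "Suc k" i] i that \<pi>(2) by auto
    then have "U k (y (\<pi> (Suc k))) \<le> U k (y (\<pi> i))"
      unfolding U using Q.Sfun_antimono[OF oQ i(3)] y_in \<pi>_in i by auto
    moreover have "\<pi> (Suc k) \<noteq> \<pi> i" using inj that by (auto dest: injD)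
    ultimately show ?thesis using neq[OF \<open>k < m\<close> \<pi>_in[OF i(2)] \<pi>_in[OF i(1)]] by simp
  qed
  have "peeled U s y"
    unfolding peeled_def using less len nth \<open>m \<le> N\<close> by auto
  moreover have "y i \<in> residual ?Q U s y" if i: "i \<in> {1..N} - set s" for i
  proof -
    obtain j where j: "i = \<pi> j" "j \<in> {1..N}" using i permutes_image[OF \<pi>(1)] by blast
    then have "m < j" using i by (auto simp: set_s)
    then show ?thesis unfolding residual_def using less len nth j y_in[of i] i by auto
  qed
  moreover have "measure ?Q (residual ?Q U s y) \<le> Dfun P m le N ?x"
  proof -
    define D where "D = {z \<in> space P. \<forall>k\<in>{1..m}. le k (hmin le N k ?x) z}"
    have x_in: "?x i \<in> space P" if "i \<in> {1..N}" for i
      using y_in[OF that] that by (auto simp: compose_def space_ext)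
    have h: "hmin le N k ?x \<in> space P" "\<And>i. i \<in> {1..N} \<Longrightarrow> le k (hmin le N k ?x) (?x i)" if "k \<in> {1..m}" for k
    proof -
      have "1 \<le> N" using that \<open>m \<le> N\<close> by simp
      then show "hmin le N k ?x \<in> space P" "\<And>i. i \<in> {1..N} \<Longrightarrow> le k (hmin le N k ?x) (?x i)"
        using hmin_props[of P m le k N ?x] o that x_in by blast+
    qed
    have D: "D \<in> sets P"
      unfolding D_def using sets_upper[OF o] h(1) by (intro sets.sets_Collect_finite_All) auto
    have "residual ?Q U s y \<subseteq> D \<times> {0..1}"
    proof
      fix z assume z: "z \<in> residual ?Q U s y"
      then have zQ: "z \<in> space ?Q" and zP: "fst z \<in> space P" by (auto simp: residual_def space_ext)
      have "le k (hmin le N k ?x) (fst z)" if k: "k \<in> {1..m}" for k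
      proof -
        have i: "k \<in> {1..N}" "\<pi> k \<in> {1..N}" using k \<open>m \<le> N\<close> \<pi>_in by auto
        have "U (k - 1) (y (\<pi> k)) < U (k - 1) z"
        proof -
          have k1: "k - 1 < m" "Suc (k - 1) = k" using k by auto
          then have "U (k - 1) (y (s ! (k - 1))) < U (k - 1) z"
            using z by (simp add: residual_def len)
          then show ?thesis using nth[OF k1(1)] k1(2) by simp
        qed
        \<comment> \<open>\<open>U (k - 1)\<close> is monotone along the order, so its strict
          inequality rules out the reverse relation; totality gives the wanted one.\<close>
        then have "\<not> ext_rel le k z (y (\<pi> k))"
          using Q.Sfun_antimono[OF oQ k zQ y_in[OF i(2)]] k unfolding U by auto
        then have "ext_rel le k (y (\<pi> k)) z"
          using ordered_spaceD(3)[OF oQ k zQ y_in[OF i(2)]] by blast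
        then have "le k (?x (\<pi> k)) (fst z)"
          using i by (auto simp: ext_rel_def ltr_def eqr_def compose_def)
        then show ?thesis
          using ordered_spaceD(2)[OF o k h(1)[OF k] x_in[OF i(2)] zP h(2)[OF k i(2)]] by blast
      qed
      then show "z \<in> D \<times> {0..1}" using zQ by (auto simp: D_def space_ext)
    qed
    then have "measure ?Q (residual ?Q U s y) \<le> measure ?Q (D \<times> {0..1})"
      using D unfolding ext_space_def
      by (intro finite_measure.finite_measure_mono[OF Q.finite_measure_axioms[unfolded ext_space_def]] pair_measureI)
        (auto simp: sets_restrict_space_iff)
    also have "measure ?Q (D \<times> {0..1}) = measure P D"
    proof -
      have "emeasure ?Q (D \<times> {0..1}) = emeasure P D * emeasure (restrict_space lebesgue {0..1::real}) {0..1}"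
        unfolding ext_space_def using D
        by (intro L.emeasure_pair_measure_Times) (auto simp: sets_restrict_space_iff)
      also have "emeasure (restrict_space lebesgue {0..1::real}) {0..1} = 1"
        using L.emeasure_space_1 by (simp add: space_restrict_space)
      finally show ?thesis by (simp add: measure_def)
    qed
    finally show ?thesis by (simp add: Dfun_def D_def)
  qed
  moreover have "distinct s" 
    using inj_on_subset[OF inj subset_UNIV] by (simp add: s_def distinct_map del: upt_Suc)
  moreover have "set s \<subseteq> {1..N}" using \<pi>_in \<open>m \<le> N\<close> by (auto simp: set_s)
  ultimately show ?thesis using len by blast
qed

subsection \<open>The theorem\<close>

theorem theoremA2:
  fixes P :: "'a measure" and le :: "nat \<Rightarrow> 'a \<Rightarrow> 'a \<Rightarrow> bool"
    and m N :: nat and \<alpha> :: real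
    and tilde :: "(nat \<Rightarrow> 'a \<times> real) \<Rightarrow> nat \<Rightarrow> 'a \<times> real"
  assumes "prob_space P"
    and "ordered_space P m le"
    and "m \<le> N"
    and "0 \<le> \<alpha>" "\<alpha> \<le> 1"
    and "condA1 P m le N"
    and "valid_tilde (ext_space P) m (ext_rel le) N tilde"
    and "condA2 (ext_space P) m (ext_rel le) N tilde"
    and "condA3 (ext_space P) m (ext_rel le)"
    and "condA4 (ext_space P) m (ext_rel le)"
    and "condA5 (ext_space P) m (ext_rel le) N tilde"
  shows "measure (powN P N) {x \<in> space (powN P N). Dfun P m le N x < 1 - \<alpha>}
           \<le> (\<Sum>k<m. real (N choose k) * \<alpha> ^ k * (1 - \<alpha>) ^ (N - k))"
proof -
  let ?Q = "ext_space P" and ?I = "{1..N}"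
  let ?PN = "PiM ?I (\<lambda>_. P)" and ?QN = "PiM ?I (\<lambda>_. ext_space P)"
  interpret P: prob_space P by (rule assms(1))
  interpret Q: prob_space ?Q by (rule prob_space_ext[OF assms(1)])
  note oQ = ordered_space_ext[OF assms(2)]
  \<comment> \<open>\<open>Sfun\<close> reverses the order, hence the sign; \<open>Suc k\<close>
    translates list positions into orders.\<close>
  define U where "U = (\<lambda>k y. - Sfun ?Q (ext_rel le) (Suc k) y)"
  have U: "U k \<in> borel_measurable ?Q" if "k < m" for k
    unfolding U_def using Q.measurable_Sfun[OF oQ _ assms(9), of "Suc k"] that by auto
  have null: "Q.prob {y \<in> space ?Q. U k y = c} = 0" if "k < m" for k c
  proof -
    have "{y \<in> space ?Q. U k y = c} = {y \<in> space ?Q. Sfun ?Q (ext_rel le) (Suc k) y = - c}"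
      by (auto simp: U_def)
    then show ?thesis
      using Q.Sfun_level_null[OF oQ _ assms(10,9) ext_ties_null[OF assms(1,2)], of "Suc k" "- c"] that
      by simp
  qed
  define A where "A = {x \<in> space (powN P N). Dfun P m le N x < 1 - \<alpha>}"
  \<comment> \<open>(A1) makes \<open>A\<close> measurable in the completion. Its main part
    \<open>B\<close> has the same measure but lies in the plain product \<sigma>-algebra, so its
    preimage under the projection is measurable; \<open>B \<subseteq> A\<close> preserves the bound
    on \<open>Dfun\<close>.\<close>
  define B where "B = main_part ?PN A"
  have A: "A \<in> sets (completion ?PN)"
    using assms(6) unfolding A_def condA1_def powN_def by measurable
  have B: "B \<in> sets ?PN" "B \<subseteq> A"
    using A main_part_null_part_Un[OF A] unfolding B_def by (simp, blast)
  define E where "E = (\<Union>s\<in>{s. length s = m \<and> distinct s \<and> set s \<subseteq> ?I}.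
      {y \<in> space ?QN. peeled U s y \<and> (\<forall>i\<in>?I - set s. y i \<in> residual ?Q U s y) \<and>
        Q.prob (residual ?Q U s y) < 1 - \<alpha>})"
  have E: "E \<in> sets ?QN" "emeasure ?QN E \<le> ennreal (\<Sum>k<m. real (N choose k) * \<alpha> ^ k * (1 - \<alpha>) ^ (N - k))"
  proof -
    have c: "0 \<le> 1 - \<alpha>" "1 - \<alpha> \<le> 1" "finite ?I" "m \<le> card ?I" using assms(3-5) by auto
    show "E \<in> sets ?QN"
      unfolding E_def by (intro Q.emeasure_Union_peeled_le(1)) (use U null c in auto)
    have "emeasure ?QN E \<le> ennreal (\<Sum>k<m. real (card ?I choose k) * (1 - (1 - \<alpha>)) ^ k * (1 - \<alpha>) ^ (card ?I - k))"
      unfolding E_def by (intro Q.emeasure_Union_peeled_le(2)) (use U null c in auto)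
    then show "emeasure ?QN E \<le> ennreal (\<Sum>k<m. real (N choose k) * \<alpha> ^ k * (1 - \<alpha>) ^ (N - k))"
      by simp
  qed
  have fst_m: "fst \<in> measurable ?Q P" unfolding ext_space_def by simp
  have "P = distr ?Q P fst"
    unfolding ext_space_def
    by (rule prob_space.distr_pair_fst[OF prob_space_restrict_lebesgue, symmetric])
  \<comment> \<open>Forgetting the added coordinates carries the extended product measure to the
    original one; \<open>compose\<close> keeps the values outside the index set undefined, as the
    product space demands.\<close>
  then have PN: "?PN = distr ?QN ?PN (compose ?I fst)"
    using distr_PiM_finite_prob_space'[of ?I "\<lambda>_. ?Q" "\<lambda>_. P" fst] fst_m
      assms(1) Q.prob_space_axioms by simp
  have comp: "compose ?I fst \<in> measurable ?QN ?PN"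
    using fst_m unfolding compose_def by measurable
  have "AE y in ?QN. \<forall>k\<in>{..<m}. \<forall>i\<in>?I. \<forall>j\<in>?I. i \<noteq> j \<longrightarrow> U k (y i) \<noteq> U k (y j)"
  proof (intro AE_finite_allI)
    fix k i j assume *: "k \<in> {..<m}" "i \<in> ?I" "j \<in> ?I"
    show "AE y in ?QN. i \<noteq> j \<longrightarrow> U k (y i) \<noteq> U k (y j)"
      using * U null by (cases "i = j") (auto intro!: Q.AE_PiM_neq)
  qed auto
  \<comment> \<open>Away from ties, a sample projecting into \<open>B\<close> has a peeling order
    whose residual mass is at most \<open>Dfun\<close>, hence below
    \<open>1 - \<alpha>\<close>.\<close>
  then have AE: "AE y in ?QN. y \<in> compose ?I fst -` B \<inter> space ?QN \<longrightarrow> y \<in> E"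
  proof (eventually_elim, intro impI)
    fix y assume neq: "\<forall>k\<in>{..<m}. \<forall>i\<in>?I. \<forall>j\<in>?I. i \<noteq> j \<longrightarrow> U k (y i) \<noteq> U k (y j)"
      and y: "y \<in> compose ?I fst -` B \<inter> space ?QN"
    then have "y \<in> PiE ?I (\<lambda>_. space ?Q)" by (simp add: space_PiM)
    then obtain s where "length s = m \<and> distinct s \<and> set s \<subseteq> ?I \<and> peeled U s y \<and>
        (\<forall>i\<in>?I - set s. y i \<in> residual ?Q U s y) \<and>
        Q.prob (residual ?Q U s y) \<le> Dfun P m le N (compose ?I fst y)"
      using ex_peeling_order[OF assms(1,2,3,7) U_def] neq by blast
    moreover have "Dfun P m le N (compose ?I fst y) < 1 - \<alpha>"
      using y B(2) by (auto simp: A_def)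
    ultimately show "y \<in> E" using y unfolding E_def by auto
  qed
  have "emeasure (powN P N) A = emeasure ?PN B"
    using A by (simp add: powN_def B_def)
  also have "\<dots> = emeasure ?QN (compose ?I fst -` B \<inter> space ?QN)"
    using B(1) comp by (subst PN, subst emeasure_distr) auto
  also have "\<dots> \<le> emeasure ?QN E" using AE E(1) by (rule emeasure_mono_AE)
  also note E(2)
  finally have "emeasure (powN P N) A \<le> ennreal (\<Sum>k<m. real (N choose k) * \<alpha> ^ k * (1 - \<alpha>) ^ (N - k))" .
  then show ?thesis
    using assms(4,5) unfolding A_def measure_def
    by (intro enn2real_leI) (auto intro!: sum_nonneg)
qed

end
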